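(* Let $p$ be a prime with $p\equiv1\pmod3$. Then $$\sum_{k=0}^{p-1}\frac{\binom{2k}k\binom{3k}k}{27^k}\cdot\frac p{3k+1}\equiv\binom{2(p-1)/3}{(p-1)/3}\pmod{p^2}.$$
   Context: Congruences are taken in the ring $\mathbb Z_p$ of rational numbers whose denominators are not divisible by $p$. *)

theory Defs
  imports "HOL-Number_Theory.Number_Theory"
begin

definition p_integral_rats :: "nat \<Rightarrow> rat set" where
  "p_integral_rats p = {x. \<not> int p dvd snd (quotient_of x)}"

text \<open>
  Congruence of \<open>x\<close> and \<open>y\<close> modulo the principal ideal generated by \<open>m\<close> in the ring
  \<^term>\<open>p_integral_rats p\<close>. The relation includes membership of both sides in the ring.
\<close>

definition p_integral_cong :: "nat \<Rightarrow> rat \<Rightarrow> rat \<Rightarrow> rat \<Rightarrow> bool" where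
  "p_integral_cong p x y m \<longleftrightarrow>
     x \<in> p_integral_rats p \<and> y \<in> p_integral_rats p \<and>
     (\<exists>z \<in> p_integral_rats p. x - y = m * z)"

end

theory Submission imports Defs begin

text \<open>
  Write \<open>p = 3 n + 1\<close> with \<open>n\<close> even, and let \<open>H\<close> denote harmonic numbers. Since \<open>n\<close> is congruent to
  \<open>- 1 / 3\<close> modulo \<open>p\<close>, the coefficient \<open>C(2k,k) C(3k,k) / 27^k\<close> is congruent modulo \<open>p\<close> to
  \<open>(-1)^k C(n,k) C(n+k,k)\<close>, and \<open>3 k + 1\<close> to \<open>3 (k - n)\<close>. Only \<open>k = n\<close> gives a denominator divisible
  by \<open>p\<close>, and the remaining terms add up, modulo \<open>p^2\<close>, to \<open>p / 3\<close> times the exact sum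
  \<open>C(2n,n) (2 H(n) - H(2n))\<close>. The pairing \<open>i \<mapsto> p - i\<close> makes \<open>H(2n)\<close> congruent to \<open>H(n)\<close>. The term
  \<open>k = n\<close> is \<open>C(2n,n) C(3n,n) / 27^n\<close>, where modulo \<open>p^2\<close> the binomial \<open>C(3n,n) = C(p-1,n)\<close> is
  \<open>1 - p H(n)\<close> and \<open>27^n\<close> is \<open>1 - (2/3) p H(n)\<close>. The contributions of \<open>H(n)\<close> cancel.
\<close>

section \<open>Congruences between p-integral rationals\<close>

text \<open>The reduced denominator divides every other denominator of \<open>x\<close>, so
  membership can be tested on fractions not in lowest terms. The closure properties below rest on
  this.\<close>

lemma p_integral_rats_iff:
  assumes "prime p"
  shows "x \<in> p_integral_rats p \<longleftrightarrow> (\<exists>a b. x = of_int a / of_int b \<and> \<not> int p dvd b)"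
proof
  assume "x \<in> p_integral_rats p"
  then show "\<exists>a b. x = of_int a / of_int b \<and> \<not> int p dvd b"
    unfolding p_integral_rats_def
    by (metis (mono_tags) mem_Collect_eq prod.collapse quotient_of_div)
next
  assume "\<exists>a b. x = of_int a / of_int b \<and> \<not> int p dvd b"
  then obtain a b where x: "x = of_int a / of_int b" and b: "\<not> int p dvd b" by blast
  obtain c d where cd: "quotient_of x = (c, d)" by fastforce
  have d: "d > 0" "coprime c d" "x = of_int c / of_int d"
    using cd quotient_of_denom_pos quotient_of_coprime quotient_of_div by auto
  have "b \<noteq> 0" using b by auto
  then have "(of_int (a * d) :: rat) = of_int (c * b)"
    using x d by (simp add: field_simps)
  then have "a * d = c * b" by (simp only: of_int_eq_iff)
  then have "d dvd b"
    using d(2) by (metis coprime_commute coprime_dvd_mult_right_iff dvd_triv_right)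
  then have "\<not> int p dvd d" using b dvd_trans by blast
  then show "x \<in> p_integral_rats p" by (simp add: p_integral_rats_def cd)
qed

context
  fixes p :: nat
  assumes p: "prime p"
begin

lemma p_integral_of_int [simp]: "of_int a \<in> p_integral_rats p"
proof -
  have "\<not> int p dvd 1" using p by auto
  then show ?thesis
    unfolding p_integral_rats_iff[OF p] by (metis div_by_1 of_int_1)
qed

lemma p_integral_of_nat [simp]: "of_nat a \<in> p_integral_rats p"
  using p_integral_of_int[of "int a"] by simp

lemma p_integral_0 [simp]: "0 \<in> p_integral_rats p"
  and p_integral_1 [simp]: "1 \<in> p_integral_rats p"
  and p_integral_numeral [simp]: "numeral w \<in> p_integral_rats p"
  using p_integral_of_int[of 0] p_integral_of_int[of 1] p_integral_of_int[of "numeral w"] by simp_all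

lemma p_integral_add [simp]:
  assumes "x \<in> p_integral_rats p" "y \<in> p_integral_rats p"
  shows "x + y \<in> p_integral_rats p"
proof -
  obtain a b c d where "x = of_int a / of_int b" "\<not> int p dvd b"
    "y = of_int c / of_int d" "\<not> int p dvd d"
    using assms unfolding p_integral_rats_iff[OF p] by blast
  moreover from this have "b \<noteq> 0" "d \<noteq> 0" by auto
  ultimately have "x + y = of_int (a * d + c * b) / of_int (b * d)" "\<not> int p dvd b * d"
    using p by (auto simp: field_simps prime_dvd_mult_iff)
  then show ?thesis unfolding p_integral_rats_iff[OF p] by blast
qed

lemma p_integral_mult [simp]:
  assumes "x \<in> p_integral_rats p" "y \<in> p_integral_rats p"
  shows "x * y \<in> p_integral_rats p"
proof -
  obtain a b c d where "x = of_int a / of_int b" "\<not> int p dvd b"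
    "y = of_int c / of_int d" "\<not> int p dvd d"
    using assms unfolding p_integral_rats_iff[OF p] by blast
  then have "x * y = of_int (a * c) / of_int (b * d)" "\<not> int p dvd b * d"
    using p by (auto simp: prime_dvd_mult_iff)
  then show ?thesis unfolding p_integral_rats_iff[OF p] by blast
qed

lemma p_integral_minus [simp]:
  "x \<in> p_integral_rats p \<Longrightarrow> - x \<in> p_integral_rats p"
  using p_integral_mult[OF p_integral_of_int[of "- 1"]] by simp

lemma p_integral_diff [simp]:
  "x \<in> p_integral_rats p \<Longrightarrow> y \<in> p_integral_rats p \<Longrightarrow> x - y \<in> p_integral_rats p"
  using p_integral_add[of x "- y"] by simp

lemma p_integral_power [simp]: "x \<in> p_integral_rats p \<Longrightarrow> x ^ k \<in> p_integral_rats p"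
  by (induction k) simp_all

lemma p_integral_sum [simp]:
  "(\<And>i. i \<in> A \<Longrightarrow> f i \<in> p_integral_rats p) \<Longrightarrow> sum f A \<in> p_integral_rats p"
  by (induction A rule: infinite_finite_induct) simp_all

lemma p_integral_prod:
  "(\<And>i. i \<in> A \<Longrightarrow> f i \<in> p_integral_rats p) \<Longrightarrow> prod f A \<in> p_integral_rats p"
  by (induction A rule: infinite_finite_induct) simp_all

lemma p_integral_divide_of_int:
  assumes "x \<in> p_integral_rats p" "\<not> int p dvd b"
  shows "x / of_int b \<in> p_integral_rats p"
proof -
  have "1 / of_int b \<in> p_integral_rats p"
    unfolding p_integral_rats_iff[OF p] using assms(2) by (metis of_int_1)
  from p_integral_mult[OF assms(1) this] show ?thesis by simp
qed

lemma p_integral_divide_of_nat: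
  "x \<in> p_integral_rats p \<Longrightarrow> \<not> p dvd b \<Longrightarrow> x / of_nat b \<in> p_integral_rats p"
  using p_integral_divide_of_int[of x "int b"] by simp

text \<open>Only the difference is constrained, so integrality of single terms is asked for just
  where a product requires it. The exponent \<open>m\<close> allows passing between the moduli
  \<open>p\<close> and \<open>p^2\<close>.\<close>

definition pow_cong :: "nat \<Rightarrow> rat \<Rightarrow> rat \<Rightarrow> bool" where
  "pow_cong m x y \<longleftrightarrow> (\<exists>z \<in> p_integral_rats p. x - y = of_nat p ^ m * z)"

lemma pow_congI: "z \<in> p_integral_rats p \<Longrightarrow> x - y = of_nat p ^ m * z \<Longrightarrow> pow_cong m x y"
  unfolding pow_cong_def by blast

lemma pow_cong_refl [simp]: "pow_cong m x x"
  by (rule pow_congI[of 0]) simp_all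

lemma pow_cong_add:
  assumes "pow_cong m x y" "pow_cong m u v"
  shows "pow_cong m (x + u) (y + v)"
proof -
  obtain z w where "z \<in> p_integral_rats p" "x - y = of_nat p ^ m * z"
    "w \<in> p_integral_rats p" "u - v = of_nat p ^ m * w"
    using assms unfolding pow_cong_def by blast
  then show ?thesis by (intro pow_congI[of "z + w"]) (auto simp: algebra_simps)
qed

lemma pow_cong_mult_right:
  assumes "c \<in> p_integral_rats p" "pow_cong m x y"
  shows "pow_cong m (c * x) (c * y)"
proof -
  obtain z where "z \<in> p_integral_rats p" "x - y = of_nat p ^ m * z"
    using assms unfolding pow_cong_def by blast
  then show ?thesis using assms
    by (intro pow_congI[of "c * z"]) (auto simp: right_diff_distrib[symmetric])
qed

lemma pow_cong_trans:
  assumes "pow_cong m x y" "pow_cong m y z"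
  shows "pow_cong m x z"
  using pow_cong_add[OF assms] unfolding pow_cong_def by simp

lemma pow_cong_sym:
  assumes "pow_cong m x y" shows "pow_cong m y x"
proof -
  obtain z where "z \<in> p_integral_rats p" "x - y = of_nat p ^ m * z"
    using assms unfolding pow_cong_def by blast
  then show ?thesis by (intro pow_congI[of "- z"]) (auto simp: algebra_simps)
qed

text \<open>Comes from \<open>x * u - y * v = x * (u - v) + v * (x - y)\<close>, hence integrality
  of the cofactors \<open>x\<close> and \<open>v\<close>.\<close>

lemma pow_cong_mult:
  assumes "pow_cong m x y" "pow_cong m u v" "x \<in> p_integral_rats p" "v \<in> p_integral_rats p"
  shows "pow_cong m (x * u) (y * v)"
  using pow_cong_trans[OF pow_cong_mult_right[OF assms(3,2)]] pow_cong_mult_right[OF assms(4,1)]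
  by (simp add: mult.commute)

lemma pow_cong_sum:
  "(\<And>i. i \<in> A \<Longrightarrow> pow_cong m (f i) (g i)) \<Longrightarrow> pow_cong m (sum f A) (sum g A)"
  by (induction A rule: infinite_finite_induct) (simp_all add: pow_cong_add)

text \<open>A term with an explicit factor \<open>p\<close> has to be known only modulo
  \<open>p\<close> in order to be known modulo \<open>p^2\<close>.\<close>

lemma pow_cong_Suc_mult:
  assumes "pow_cong m x y"
  shows "pow_cong (Suc m) (of_nat p * x) (of_nat p * y)"
proof -
  obtain z where "z \<in> p_integral_rats p" "x - y = of_nat p ^ m * z"
    using assms unfolding pow_cong_def by blast
  then show ?thesis
    by (intro pow_congI[of z]) (auto simp: right_diff_distrib[symmetric])
qed

text \<open>First-order expansion: a product of two of the terms \<open>p * a i\<close> is already a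
  multiple of \<open>p^2\<close>.\<close>

lemma pow_cong_prod_one_plus:
  assumes "finite A" "\<And>i. i \<in> A \<Longrightarrow> a i \<in> p_integral_rats p"
  shows "pow_cong 2 (\<Prod>i\<in>A. 1 + of_nat p * a i) (1 + of_nat p * (\<Sum>i\<in>A. a i))"
  using assms
proof (induction A rule: finite_induct)
  case (insert j A)
  let ?s = "\<Sum>i\<in>A. a i"
  have "pow_cong 2 ((1 + of_nat p * a j) * (\<Prod>i\<in>A. 1 + of_nat p * a i))
          ((1 + of_nat p * a j) * (1 + of_nat p * ?s))"
    using insert by (intro pow_cong_mult_right) auto
  moreover have "pow_cong 2 ((1 + of_nat p * a j) * (1 + of_nat p * ?s)) (1 + of_nat p * (a j + ?s))"
    using insert by (intro pow_congI[of "a j * ?s"]) (auto simp: algebra_simps power2_eq_square)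
  ultimately show ?case using insert by (auto intro: pow_cong_trans)
qed simp

end

section \<open>Binomial sums with harmonic numbers\<close>

definition harm_rat :: "nat \<Rightarrow> rat" where
  "harm_rat n = (\<Sum>i=1..n. 1 / of_nat i)"

lemma harm_rat_0 [simp]: "harm_rat 0 = 0"
  and harm_rat_Suc: "harm_rat (Suc n) = harm_rat n + 1 / of_nat (Suc n)"
  by (simp_all add: harm_rat_def)

text \<open>The sum is an \<open>n\<close>-fold backward difference in \<open>m\<close>. By Pascal's
  rule each difference lowers both entries of \<open>m choose r\<close> by one.\<close>

lemma alternating_binomial_sum:
  assumes "n \<le> r" "r \<le> m"
  shows "(\<Sum>j\<le>n. (-1) ^ j * of_nat (n choose j) * of_nat ((m - j) choose r) :: rat)
           = of_nat ((m - n) choose (r - n))"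
  using assms
proof (induction n arbitrary: m)
  case (Suc n)
  let ?f = "\<lambda>m j. (-1) ^ j * of_nat (n choose j) * of_nat ((m - j) choose r) :: rat"
  have "(\<Sum>j\<le>Suc n. (-1) ^ j * of_nat (Suc n choose j) * of_nat ((m - j) choose r) :: rat)
      = of_nat (m choose r) + (\<Sum>j\<le>n. (-1) ^ Suc j * of_nat (Suc n choose Suc j) * of_nat ((m - Suc j) choose r))"
    by (subst sum.atMost_Suc_shift) simp
  also have "\<dots> = of_nat (m choose r) + (\<Sum>j\<le>n. ?f m (Suc j) - ?f (m - 1) j)"
    by (intro arg_cong2[where f="(+)"] refl sum.cong) (auto simp: algebra_simps)
  also have "\<dots> = (\<Sum>j\<le>Suc n. ?f m j) - (\<Sum>j\<le>n. ?f (m - 1) j)"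
    by (subst sum.atMost_Suc_shift) (simp add: sum_subtractf)
  also have "(\<Sum>j\<le>Suc n. ?f m j) = (\<Sum>j\<le>n. ?f m j)"
    by simp
  finally have *: "(\<Sum>j\<le>Suc n. (-1) ^ j * of_nat (Suc n choose j) * of_nat ((m - j) choose r) :: rat)
      = (\<Sum>j\<le>n. ?f m j) - (\<Sum>j\<le>n. ?f (m - 1) j)" .
  show ?case
  proof (cases "m = r")
    case True
    \<comment> \<open>Here \<open>m - 1 < r\<close>, out of reach of the induction hypothesis, but
      then every binomial in this sum vanishes.\<close>
    have "(\<Sum>j\<le>n. ?f (m - 1) j) = 0"
      using True Suc.prems by (intro sum.neutral) (auto simp: binomial_eq_0)
    with * Suc.IH[of m] Suc.prems True show ?thesis by simp
  next
    case False
    obtain a b where "m - n = Suc a" "r - n = Suc b" "m - Suc n = a" "r - Suc n = b"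
      using Suc.prems by (metis Suc_diff_le Suc_leD diff_Suc_Suc le_trans)
    with * Suc.IH[of m] Suc.IH[of "m - 1"] Suc.prems False show ?thesis
      by simp
  qed
qed simp

text \<open>Induction by \<open>C(n+1,j) / j = C(n,j) / j + C(n+1,j) / (n+1)\<close>: each step adds
  an alternating sum without the divisor \<open>j\<close>, which
  \<open>alternating_binomial_sum\<close> evaluates.\<close>

lemma alternating_binomial_sum_div:
  assumes "n \<le> r" "r \<le> m"
  shows "(\<Sum>j=1..n. (-1) ^ (j - 1) * of_nat (n choose j) * of_nat ((m - j) choose r) / of_nat j :: rat)
           = of_nat (m choose r) * harm_rat n - (\<Sum>i=1..n. of_nat ((m - i) choose (r - i)) / of_nat i)"
  using assms
proof (induction n)
  case (Suc n)
  let ?g = "\<lambda>n j. (-1) ^ (j - 1) * of_nat (n choose j) * of_nat ((m - j) choose r) / of_nat j :: rat"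
  let ?h = "\<lambda>j. (-1) ^ j * of_nat (Suc n choose j) * of_nat ((m - j) choose r) :: rat"
  have *: "?g (Suc n) j = ?g n j - ?h j / of_nat (Suc n)" if j: "j \<in> {1..Suc n}" for j
  proof -
    obtain i where i: "j = Suc i" using j by (cases j) auto
    have "of_nat (Suc i) * of_nat (Suc n choose Suc i) = (of_nat (Suc n) * of_nat (n choose i) :: rat)"
      unfolding of_nat_mult[symmetric] by (simp only: Suc_times_binomial_eq mult.commute)
    then have e: "of_nat (n choose i) = of_nat (Suc i) * of_nat (Suc n choose Suc i) / (of_nat (Suc n) :: rat)"
      by (simp add: field_simps del: of_nat_Suc binomial_Suc_Suc)
    have "(of_nat (n choose Suc i) :: rat) = of_nat (Suc n choose Suc i) - of_nat (n choose i)"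
      by simp
    also have "\<dots> = of_nat (Suc n choose Suc i) - of_nat (Suc i) * of_nat (Suc n choose Suc i) / of_nat (Suc n)"
      by (simp only: e)
    finally have q: "(of_nat (n choose Suc i) :: rat) =
      of_nat (Suc n choose Suc i) - of_nat (Suc i) * of_nat (Suc n choose Suc i) / of_nat (Suc n)" .
    show ?thesis
      unfolding i q by (simp add: field_simps del: binomial_Suc_Suc of_nat_Suc)
  qed
  have "(\<Sum>j=1..Suc n. ?g (Suc n) j) = (\<Sum>j=1..Suc n. ?g n j) - (\<Sum>j=1..Suc n. ?h j) / of_nat (Suc n)"
    unfolding sum_divide_distrib sum_subtractf[symmetric] by (rule sum.cong[OF refl *])
  \<comment> \<open>The absent term \<open>j = 0\<close> is what builds up the harmonic
    number.\<close>
  also have "(\<Sum>j=1..Suc n. ?h j) = (\<Sum>j\<le>Suc n. ?h j) - of_nat (m choose r)"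
    by (subst sum.atMost_Suc_shift) (simp add: sum.shift_bounds_cl_Suc_ivl atLeast0AtMost del: sum.cl_ivl_Suc binomial_Suc_Suc)
  also have "(\<Sum>j\<le>Suc n. ?h j) = of_nat ((m - Suc n) choose (r - Suc n))"
    by (rule alternating_binomial_sum[OF Suc.prems])
  finally have "(\<Sum>j=1..Suc n. ?g (Suc n) j) = (\<Sum>j=1..n. ?g n j)
      - (of_nat ((m - Suc n) choose (r - Suc n)) - of_nat (m choose r)) / of_nat (Suc n)"
    by (simp add: binomial_eq_0)
  moreover have "(\<Sum>j=1..n. ?g n j) = of_nat (m choose r) * harm_rat n
      - (\<Sum>i=1..n. of_nat ((m - i) choose (r - i)) / of_nat i)"
    using Suc by simp
  ultimately show ?case
    by (simp add: harm_rat_Suc algebra_simps diff_divide_distrib)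
qed simp

text \<open>Double induction: Pascal's rule splits the sum into one with smaller \<open>d\<close>
  and one with smaller \<open>r\<close>.\<close>

lemma binomial_reciprocal_sum:
  "(\<Sum>i=1..r. of_nat ((d + r - i) choose d) / of_nat i :: rat)
     = of_nat ((d + r) choose d) * (harm_rat (d + r) - harm_rat d)"
proof (induction d arbitrary: r)
  case 0
  then show ?case by (simp add: harm_rat_def)
next
  case (Suc d)
  note IH = Suc
  show ?case
  proof (induction r)
    case (Suc r)
    have "(\<Sum>i=1..Suc r. of_nat ((Suc d + Suc r - i) choose Suc d) / of_nat i :: rat)
      = (\<Sum>i=1..Suc r. of_nat ((d + Suc r - i) choose d) / of_nat i
          + of_nat ((Suc d + r - i) choose Suc d) / of_nat i)"
    proof (intro sum.cong refl)
      fix i assume "i \<in> {1..Suc r}"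
      then have "Suc d + Suc r - i = Suc (d + Suc r - i)" "Suc d + r - i = d + Suc r - i" by auto
      then show "of_nat ((Suc d + Suc r - i) choose Suc d) / of_nat i
        = of_nat ((d + Suc r - i) choose d) / of_nat i
          + (of_nat ((Suc d + r - i) choose Suc d) / of_nat i :: rat)"
        by (simp add: add_divide_distrib)
    qed
    \<comment> \<open>In the second sum the term \<open>i = Suc r\<close> contains
      \<open>d choose Suc d = 0\<close>, so the inner hypothesis for \<open>r\<close>
      applies.\<close>
    also have "\<dots> = of_nat ((d + Suc r) choose d) * (harm_rat (d + Suc r) - harm_rat d)
       + of_nat ((Suc d + r) choose Suc d) * (harm_rat (Suc d + r) - harm_rat (Suc d))"
      unfolding sum.distrib IH using Suc by (simp add: binomial_eq_0)
    also have "\<dots> = of_nat ((Suc d + Suc r) choose Suc d) * (harm_rat (Suc d + Suc r) - harm_rat (Suc d))"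
    proof -
      let ?N = "Suc (d + r)"
      \<comment> \<open>Absorption makes the two new reciprocals, \<open>1 / Suc d\<close> and
        \<open>1 / Suc ?N\<close>, cancel against each other.\<close>
      have "of_nat (Suc d) * of_nat (Suc ?N choose Suc d) = (of_nat (Suc ?N) * of_nat (?N choose d) :: rat)"
        unfolding of_nat_mult[symmetric] by (simp only: Suc_times_binomial_eq mult.commute)
      then have "of_nat (?N choose d) / of_nat (Suc d) = (of_nat (Suc ?N choose Suc d) / of_nat (Suc ?N) :: rat)"
        by (simp add: field_simps del: of_nat_Suc binomial_Suc_Suc)
      moreover have "(of_nat (Suc ?N choose Suc d) :: rat) = of_nat (?N choose d) + of_nat (?N choose Suc d)"
        by simp
      moreover have "harm_rat (Suc ?N) = harm_rat ?N + 1 / of_nat (Suc ?N)"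
        "harm_rat (Suc d) = harm_rat d + 1 / of_nat (Suc d)"
        by (rule harm_rat_Suc)+
      ultimately show ?thesis
        by (simp add: algebra_simps add_divide_distrib del: of_nat_Suc binomial_Suc_Suc)
    qed
    finally show ?case .
  qed simp
qed

text \<open>The case \<open>r = n\<close>, \<open>m = 2 * n\<close> of
  \<open>alternating_binomial_sum_div\<close>; its remaining sum is
  \<open>binomial_reciprocal_sum\<close> with \<open>d = r = n\<close>.\<close>

lemma alternating_central_sum:
  "(\<Sum>j=1..n. (-1) ^ (j - 1) * of_nat (n choose j) * of_nat ((2 * n - j) choose n) / of_nat j :: rat)
     = of_nat ((2 * n) choose n) * (2 * harm_rat n - harm_rat (2 * n))"
proof -
  have "(\<Sum>i=1..n. of_nat ((2 * n - i) choose (n - i)) / of_nat i :: rat)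
    = (\<Sum>i=1..n. of_nat ((n + n - i) choose n) / of_nat i)"
  proof (intro sum.cong refl)
    fix i assume "i \<in> {1..n}"
    then have "(2 * n - i) choose (n - i) = (n + n - i) choose n"
      using binomial_symmetric[of "n - i" "2 * n - i"] by (simp add: mult_2)
    then show "of_nat ((2 * n - i) choose (n - i)) / of_nat i = (of_nat ((n + n - i) choose n) / of_nat i :: rat)"
      by simp
  qed
  then show ?thesis
    using alternating_binomial_sum_div[of n n "2 * n"]
    unfolding binomial_reciprocal_sum by (simp add: mult_2[symmetric] algebra_simps)
qed

section \<open>The congruence\<close>

lemma central_trinomial_fact:
  "(of_nat ((2 * k) choose k) * of_nat ((3 * k) choose k) :: rat) = fact (3 * k) / fact k ^ 3"
proof -
  have "2 * k - k = k" "3 * k - k = 2 * k" by simp_all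
  then show ?thesis
    by (simp add: binomial_fact power3_eq_cube)
qed

lemma fact_triple_Suc:
  "(fact (3 * Suc k) :: 'a :: {comm_semiring_1, semiring_char_0})
     = of_nat (3 * k + 3) * of_nat (3 * k + 2) * of_nat (3 * k + 1) * fact (3 * k)"
proof -
  have e: "3 * Suc k = Suc (Suc (Suc (3 * k)))" by simp
  show ?thesis unfolding e fact_Suc of_nat_mult
    by (simp add: algebra_simps eval_nat_numeral)
qed

text \<open>The term ratio, cleared of denominators, for comparison with
  \<open>legendre_coeff_Suc\<close>.\<close>

lemma central_trinomial_Suc:
  fixes t :: "nat \<Rightarrow> rat"
  assumes "\<And>k. t k = of_nat ((2 * k) choose k) * of_nat ((3 * k) choose k) / 27 ^ k"
  shows "t (Suc k) * (9 * of_nat (Suc k) ^ 2) = t k * (of_nat (3 * k + 1) * of_nat (3 * k + 2))"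
proof -
  have "(fact (3 * Suc k) :: rat)
      = 3 * of_nat (Suc k) * of_nat (3 * k + 2) * of_nat (3 * k + 1) * fact (3 * k)"
    unfolding fact_triple_Suc by simp
  moreover have "(fact (Suc k) :: rat) = of_nat (Suc k) * fact k" by simp
  moreover have "(of_nat (Suc k) :: rat) \<noteq> 0" "(fact k :: rat) \<noteq> 0" by simp_all
  ultimately show ?thesis
    unfolding assms central_trinomial_fact
    by (simp add: field_simps power2_eq_square power3_eq_cube del: of_nat_Suc fact_Suc of_nat_add)
qed

lemma of_nat_binomial_Suc:
  "of_nat (Suc k) * of_nat (n choose Suc k) = ((of_nat n - of_nat k) * of_nat (n choose k) :: rat)"
  using gbinomial_mult_1[of "of_nat n :: rat" k]
  unfolding binomial_gbinomial by (simp add: algebra_simps)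

text \<open>These are the coefficients of the Legendre polynomial \<open>P_n(1 - 2 x)\<close>.
  Multiplied by 9, the factor on the right becomes that of \<open>central_trinomial_Suc\<close> if
  \<open>3 n\<close> is replaced by \<open>-1\<close>.\<close>

lemma legendre_coeff_Suc:
  fixes u :: "nat \<Rightarrow> rat"
  assumes "\<And>k. u k = (-1) ^ k * of_nat (n choose k) * of_nat ((n + k) choose k)"
  shows "u (Suc k) * of_nat (Suc k) ^ 2 = u k * ((of_nat k - of_nat n) * of_nat (n + k + 1))"
proof -
  have 2: "of_nat (Suc k) * of_nat ((n + Suc k) choose Suc k)
      = (of_nat (n + k + 1) * of_nat ((n + k) choose k) :: rat)"
    unfolding of_nat_mult[symmetric]
    using Suc_times_binomial_eq[of "n + k" k] by (simp add: mult.commute del: binomial_Suc_Suc)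
  have "u (Suc k) * of_nat (Suc k) ^ 2 = - ((-1) ^ k) * (of_nat (Suc k) * of_nat (n choose Suc k))
     * (of_nat (Suc k) * of_nat ((n + Suc k) choose Suc k))"
    unfolding assms by (simp add: power2_eq_square del: binomial_Suc_Suc of_nat_Suc)
  also have "\<dots> = u k * ((of_nat k - of_nat n) * of_nat (n + k + 1))"
    unfolding of_nat_binomial_Suc[of k n] 2 assms by (simp add: algebra_simps)
  finally show ?thesis .
qed

lemma prod_shifted_fact: "(\<Prod>i<n. of_nat (Suc (m + i)) :: rat) * fact m = fact (m + n)"
proof (induction n)
  case (Suc n)
  have "(\<Prod>i<Suc n. of_nat (Suc (m + i)) :: rat) * fact m
      = of_nat (Suc (m + n)) * ((\<Prod>i<n. of_nat (Suc (m + i))) * fact m)"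
    by (simp only: prod.lessThan_Suc mult_ac)
  then show ?case unfolding Suc by simp
qed simp

lemma prod_triple_fact:
  "(\<Prod>i<n. of_nat (3 * i + 3) * of_nat (3 * i + 2) * of_nat (3 * i + 1) :: rat) = fact (3 * n)"
proof (induction n)
  case (Suc n)
  then show ?case
    unfolding prod.lessThan_Suc fact_triple_Suc by (simp only: mult.commute)
qed simp

text \<open>With \<open>p = Suc m\<close> this expands \<open>C(p-1,k)\<close>, whose factors are
  \<open>(p - i) / i = - (1 - p / i)\<close>.\<close>

lemma prod_one_minus_binomial:
  "(\<Prod>i<k. 1 + of_nat (Suc m) * (- 1 / of_nat (Suc i))) = ((-1) ^ k * of_nat (m choose k) :: rat)"
proof (induction k)
  case (Suc k)
  have "1 + of_nat (Suc m) * (- 1 / of_nat (Suc k)) = (- (of_nat m - of_nat k) / of_nat (Suc k) :: rat)"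
    by (simp add: field_simps)
  then have "(\<Prod>i<Suc k. 1 + of_nat (Suc m) * (- 1 / of_nat (Suc i)))
      = (- ((-1) ^ k) * ((of_nat m - of_nat k) * of_nat (m choose k)) / of_nat (Suc k) :: rat)"
    unfolding prod.lessThan_Suc Suc by (simp only:) (simp add: field_simps del: of_nat_Suc)
  also have "\<dots> = (-1) ^ Suc k * of_nat (m choose Suc k)"
    unfolding of_nat_binomial_Suc[symmetric] by (simp del: of_nat_Suc)
  finally show ?case .
qed simp

lemma harm_rat_add: "harm_rat (m + n) - harm_rat m = (\<Sum>i<n. 1 / of_nat (Suc (m + i)))"
  by (induction n) (simp_all add: harm_rat_Suc)

lemma harm_rat_reverse: "harm_rat n = (\<Sum>i<n. 1 / of_nat (n - i))"
  using harm_rat_add[of 0 n] sum.nat_diff_reindex[of "\<lambda>i. 1 / of_nat (Suc i) :: rat" n]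
  by (simp add: Suc_diff_Suc cong: sum.cong_simp del: of_nat_Suc)

section \<open>The prime \<open>p = 3 n + 1\<close> and the terms with \<open>k\<close> different
  from \<open>n\<close>\<close>

context
  fixes p n :: nat
  assumes p: "prime p" and pn: "p = 3 * n + 1"
begin

lemma not_p_dvd_between: "0 < a \<Longrightarrow> a < p \<Longrightarrow> \<not> p dvd a"
  using nat_dvd_not_less by blast

lemma not_p_dvd_3: "\<not> p dvd 3"
proof
  assume "p dvd 3"
  then have "p \<le> 3" by (rule dvd_imp_le) simp
  with pn p show False by (cases "n = 0") auto
qed

lemma p_integral_third: "c \<in> p_integral_rats p \<Longrightarrow> c / 3 \<in> p_integral_rats p"
  using p_integral_divide_of_nat[OF p _ not_p_dvd_3] by simp

lemma not_p_dvd_27_power: "\<not> p dvd 27 ^ k"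
  using not_p_dvd_3 p prime_dvd_power[of p 3 "3 * k"] by (auto simp: power_mult)

text \<open>The even prime 2 is not of the form \<open>3 n + 1\<close>. Evenness of \<open>n\<close>
  settles the signs below and makes 2 invertible modulo \<open>p\<close>.\<close>

lemma even_third: "even n"
proof (rule ccontr)
  assume "odd n"
  then have "even p" using pn by simp
  then have "p = 2" using p primes_dvd_imp_eq two_is_prime_nat by blast
  with pn show False by presburger
qed

text \<open>Both sides start at 1 and have the same ratios modulo \<open>p\<close>; the divisor
  \<open>9 * Suc k ^ 2\<close> stays prime to \<open>p\<close> while
  \<open>Suc k < p\<close>.\<close>

lemma central_trinomial_cong_legendre_coeff:
  assumes "k < p"
  shows "pow_cong p 1 (of_nat ((2 * k) choose k) * of_nat ((3 * k) choose k) / 27 ^ k)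
           ((-1) ^ k * of_nat (n choose k) * of_nat ((n + k) choose k))"
proof -
  define t :: "nat \<Rightarrow> rat" where t: "t k = of_nat ((2 * k) choose k) * of_nat ((3 * k) choose k) / 27 ^ k" for k
  define u :: "nat \<Rightarrow> rat" where u: "u k = (-1) ^ k * of_nat (n choose k) * of_nat ((n + k) choose k)" for k
  have tI: "t k \<in> p_integral_rats p" for k
    using p_integral_divide_of_nat[OF p _ not_p_dvd_27_power,
        of "of_nat (((2 * k) choose k) * ((3 * k) choose k))" k] p
    by (simp add: t)
  have "pow_cong p 1 (t k) (u k)"
    using assms
  proof (induction k)
    case 0
    then show ?case by (simp add: t u p)
  next
    case (Suc k)
    let ?d = "9 * Suc k ^ 2"
    let ?x = "of_nat (3 * k + 1) * of_nat (3 * k + 2) :: rat"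
    let ?y = "9 * ((of_nat k - of_nat n) * of_nat (n + k + 1)) :: rat"
    \<comment> \<open>From \<open>3 n = p - 1\<close>, \<open>?y\<close> is
      \<open>(3 k + 1 - p) (3 k + 2 + p)\<close>, so the cofactor is
      \<open>p + 1 = 3 n + 2\<close>.\<close>
    have "?x - ?y = of_nat p * (of_nat (3 * n) + 2)"
      by (simp add: pn algebra_simps)
    then have xy: "pow_cong p 1 ?x ?y"
      using p by (intro pow_congI[of p "of_nat (3 * n) + 2"]) auto
    have "pow_cong p 1 (t k) (u k)" using Suc by simp
    from pow_cong_mult[OF p this xy tI]
    have "pow_cong p 1 (t k * ?x) (u k * ?y)"
      by (simp add: p)
    moreover have "\<not> p dvd ?d"
    proof
      assume "p dvd ?d"
      then have "p dvd 3 * 3 \<or> p dvd Suc k ^ 2" using p prime_dvd_mult_nat by auto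
      then have "p dvd 3 \<or> p dvd Suc k" using p prime_dvd_mult_nat prime_dvd_power by blast
      then show False using not_p_dvd_3 not_p_dvd_between[of "Suc k"] Suc.prems by simp
    qed
    then have "1 / of_nat ?d \<in> p_integral_rats p"
      using p by (intro p_integral_divide_of_nat) auto
    ultimately have "pow_cong p 1 (1 / of_nat ?d * (t k * ?x)) (1 / of_nat ?d * (u k * ?y))"
      using p by (intro pow_cong_mult_right)
    moreover have "1 / of_nat ?d * (t k * ?x) = t (Suc k)"
      using central_trinomial_Suc[of t k, OF t] by (simp add: field_simps del: of_nat_Suc)
    moreover have "1 / of_nat ?d * (u k * ?y) = u (Suc k)"
      using legendre_coeff_Suc[of u n k, OF u] by (simp add: field_simps del: of_nat_Suc)
    ultimately show ?case by simp
  qed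
  then show ?thesis by (simp add: t u)
qed

lemma term_cong:
  assumes "k < p" "k \<noteq> n"
  shows "pow_cong p 2
     (of_nat ((2 * k) choose k) * of_nat ((3 * k) choose k) / 27 ^ k * (of_nat p / of_nat (3 * k + 1)))
     (of_nat p * ((-1) ^ k * of_nat (n choose k) * of_nat ((n + k) choose k) / (3 * (of_nat k - of_nat n))))"
    (is "pow_cong p 2 (?t * _) (_ * (?u / _))")
proof -
  have nd: "\<not> p dvd 3 * k + 1"
  proof
    assume "p dvd 3 * k + 1"
    then obtain c where c: "3 * k + 1 = p * c" by blast
    \<comment> \<open>The quotient \<open>c\<close> is below 3 and, like \<open>p\<close> and
      \<open>3 k + 1\<close>, congruent to 1 modulo 3; so \<open>c = 1\<close> and
      \<open>k = n\<close>.\<close>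
    then have "p * c < p * 3" using assms(1) by linarith
    then have "c < 3" by simp
    moreover have "c mod 3 = 1"
    proof -
      have "p * c = c + 3 * (n * c)" by (simp add: pn algebra_simps)
      then show ?thesis using c by presburger
    qed
    ultimately have "c = 1" by simp
    then show False using c assms(2) pn by simp
  qed
  have nd': "\<not> int p dvd 3 * (int k - int n)"
  proof
    assume "int p dvd 3 * (int k - int n)"
    \<comment> \<open>Adding \<open>p = 3 n + 1\<close> turns \<open>3 (k - n)\<close> into
      \<open>3 k + 1\<close>.\<close>
    then have "int p dvd 3 * (int k - int n) + int p" by simp
    then have "int p dvd int (3 * k + 1)" by (simp add: pn algebra_simps)
    then show False using nd by (simp only: int_dvd_int_iff)
  qed
  have x: "1 / of_nat (3 * k + 1) \<in> p_integral_rats p"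
    using p nd by (intro p_integral_divide_of_nat) auto
  have y: "1 / (3 * (of_nat k - of_nat n)) \<in> p_integral_rats p"
    using p_integral_divide_of_int[OF p p_integral_1[OF p] nd'] by simp
  have "(of_nat k - of_nat n :: rat) \<noteq> 0" "(of_nat (3 * k + 1) :: rat) \<noteq> 0"
    using assms(2) by (simp, simp only: of_nat_eq_0_iff)
  then have "1 / of_nat (3 * k + 1) - 1 / (3 * (of_nat k - of_nat n))
     = (of_nat p ^ 1 * (- (1 / of_nat (3 * k + 1) * (1 / (3 * (of_nat k - of_nat n))))) :: rat)"
    by (simp add: divide_simps del: of_nat_add of_nat_mult) (simp add: pn algebra_simps)
  then have c: "pow_cong p 1 (1 / of_nat (3 * k + 1)) (1 / (3 * (of_nat k - of_nat n)))"
    by (rule pow_congI[OF p, rotated]) (intro p_integral_minus[OF p] p_integral_mult[OF p] x y)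
  have "pow_cong p 1 (1 / of_nat (3 * k + 1) * ?t) (1 / (3 * (of_nat k - of_nat n)) * ?u)"
    using p x by (intro pow_cong_mult c central_trinomial_cong_legendre_coeff assms) auto
  from pow_cong_Suc_mult[OF p this] show ?thesis
    by (simp add: numeral_2_eq_2 mult_ac)
qed

text \<open>Reversal by \<open>j = n - k\<close> gives \<open>alternating_central_sum\<close>. As
  \<open>n\<close> is even, \<open>(-1)^k = (-1)^j\<close>, and the sign of
  \<open>k - n = -j\<close> makes it \<open>(-1)^(j-1)\<close>.\<close>

lemma legendre_coeff_sum:
  "(\<Sum>k<n. (-1) ^ k * of_nat (n choose k) * of_nat ((n + k) choose k) / (3 * (of_nat k - of_nat n)))
     = (of_nat ((2 * n) choose n) * (2 * harm_rat n - harm_rat (2 * n)) / 3 :: rat)"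
proof -
  have "(\<Sum>k<n. (-1) ^ k * of_nat (n choose k) * of_nat ((n + k) choose k) / (3 * (of_nat k - of_nat n)) :: rat)
    = (\<Sum>j=1..n. (-1) ^ (j - 1) * of_nat (n choose j) * of_nat ((2 * n - j) choose n) / of_nat j / 3)"
  proof (rule sum.reindex_bij_witness[of _ "\<lambda>j. n - j" "\<lambda>k. n - k"])
    fix k assume "k \<in> {..<n}"
    then obtain j where j: "n = k + Suc j" by (auto simp: less_iff_Suc_add)
    have "even (k + Suc j)" using even_third j by simp
    then have s: "(-1) ^ k = - ((-1) ^ j :: rat)" by (cases "even k") auto
    have "2 * n - (n - k) = n + k" "k \<le> n" using j by simp_all
    then have "n choose (n - k) = n choose k" "(2 * n - (n - k)) choose n = (n + k) choose k"
      using binomial_symmetric[of k n] binomial_symmetric[of k "n + k"] by simp_all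
    then show "(-1) ^ (n - k - 1) * of_nat (n choose (n - k)) * of_nat ((2 * n - (n - k)) choose n) / of_nat (n - k) / 3
      = ((-1) ^ k * of_nat (n choose k) * of_nat ((n + k) choose k) / (3 * (of_nat k - of_nat n)) :: rat)"
      using s j by (simp add: field_simps)
  qed auto
  then show ?thesis
    by (simp only: sum_divide_distrib[symmetric] alternating_central_sum)
qed

section \<open>Harmonic numbers and the term \<open>k = n\<close>\<close>

lemma harm_rat_double_cong: "pow_cong p 1 (harm_rat (2 * n)) (harm_rat n)"
proof -
  let ?S = "\<Sum>i<n. 1 / of_nat (Suc (n + i)) * (1 / of_nat (2 * n - i)) :: rat"
  have T: "harm_rat (2 * n) - harm_rat n = (\<Sum>i<n. 1 / of_nat (Suc (n + i)))"
    unfolding mult_2 by (rule harm_rat_add)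
  also have "\<dots> = (\<Sum>i<n. 1 / of_nat (Suc (n + (n - Suc i))))"
    by (rule sum.nat_diff_reindex[symmetric])
  also have "\<dots> = (\<Sum>i<n. 1 / of_nat (2 * n - i))"
  proof (intro sum.cong refl)
    fix i assume "i \<in> {..<n}"
    then have "Suc (n + (n - Suc i)) = 2 * n - i" by auto
    then show "1 / of_nat (Suc (n + (n - Suc i))) = (1 / of_nat (2 * n - i) :: rat)" by (simp only:)
  qed
  finally have T': "harm_rat (2 * n) - harm_rat n = (\<Sum>i<n. 1 / of_nat (2 * n - i) :: rat)" .
  \<comment> \<open>Adding the sum to its reversal pairs \<open>n + 1 + i\<close> with
    \<open>2 n - i\<close>, and these two add up to \<open>p\<close>.\<close>
  have "2 * (harm_rat (2 * n) - harm_rat n)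
      = (\<Sum>i<n. 1 / of_nat (Suc (n + i)) + 1 / of_nat (2 * n - i))"
    unfolding sum.distrib T[symmetric] T'[symmetric] by simp
  also have "\<dots> = of_nat p * ?S"
    unfolding sum_distrib_left
  proof (intro sum.cong refl)
    fix i assume "i \<in> {..<n}"
    then have "of_nat p = (of_nat (Suc (n + i)) + of_nat (2 * n - i) :: rat)" "of_nat (2 * n - i) \<noteq> (0::rat)"
      by (simp_all add: pn of_nat_add[symmetric] del: of_nat_add)
    then show "1 / of_nat (Suc (n + i)) + 1 / of_nat (2 * n - i)
        = (of_nat p * (1 / of_nat (Suc (n + i)) * (1 / of_nat (2 * n - i))) :: rat)"
      by (simp add: divide_simps del: of_nat_Suc of_nat_diff)
  qed
  finally have e: "harm_rat (2 * n) - harm_rat n = of_nat p ^ 1 * (?S / 2)"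
    by simp
  have "1 / of_nat (Suc (n + i)) \<in> p_integral_rats p" "1 / of_nat (2 * n - i) \<in> p_integral_rats p"
    if "i < n" for i
    using that pn by (intro p_integral_divide_of_nat[OF p] not_p_dvd_between p_integral_1[OF p]; simp)+
  then have "?S \<in> p_integral_rats p"
    by (intro p_integral_sum[OF p] p_integral_mult[OF p]) simp_all
  moreover have "\<not> p dvd 2"
    using prime_gt_1_nat[OF p] even_third pn by (intro not_p_dvd_between) presburger+
  ultimately have "?S / 2 \<in> p_integral_rats p"
    using p_integral_divide_of_nat[OF p, of ?S 2] by simp
  from pow_congI[OF p this e] show ?thesis .
qed

lemma binomial_three_n_cong: "pow_cong p 2 (of_nat ((3 * n) choose n)) (1 - of_nat p * harm_rat n)"
proof -
  have "pow_cong p 2 (\<Prod>i<n. 1 + of_nat p * (- 1 / of_nat (Suc i)))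
          (1 + of_nat p * (\<Sum>i<n. - 1 / of_nat (Suc i)))"
    using p pn
    by (intro pow_cong_prod_one_plus p_integral_divide_of_nat not_p_dvd_between)
       (auto simp del: of_nat_Suc)
  moreover have "(\<Prod>i<n. 1 + of_nat p * (- 1 / of_nat (Suc i)) :: rat) = of_nat ((3 * n) choose n)"
    using prod_one_minus_binomial[where k = n and m = "3 * n"] even_third by (simp add: pn)
  moreover have "(\<Sum>i<n. - 1 / of_nat (Suc i)) = - harm_rat n"
    using harm_rat_add[of 0 n] by (simp add: sum_negf)
  ultimately show ?thesis by simp
qed

text \<open>The numerators are \<open>3 i + 2 + p = 3 (n + i + 1)\<close> and
  \<open>3 i + 1 + 2 p = 3 (2 n + i + 1)\<close>. Together with the factors \<open>3 i + 3\<close>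
  they give \<open>27^n\<close> times \<open>(3 n)!\<close>, and the denominators with these same
  factors give \<open>(3 n)!\<close>.\<close>

lemma power_27_prod:
  "(27 ^ n :: rat) = (\<Prod>i<n. 1 + of_nat p * (1 / of_nat (3 * i + 2)))
       * (\<Prod>i<n. 1 + of_nat p * (2 / of_nat (3 * i + 1)))"
    (is "_ = ?A * ?B")
proof -
  have *: "(1 + of_nat p * (1 / of_nat (3 * i + 2))) * (1 + of_nat p * (2 / of_nat (3 * i + 1)))
      * (of_nat (3 * i + 3) * of_nat (3 * i + 2) * of_nat (3 * i + 1))
      = (27 * (of_nat (Suc i) * of_nat (Suc (n + i)) * of_nat (Suc (2 * n + i))) :: rat)" for i
  proof -
    have "1 + of_nat p * (1 / of_nat (3 * i + 2)) = (3 * of_nat (Suc (n + i)) / of_nat (3 * i + 2) :: rat)"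
      by (simp add: pn divide_simps) (simp add: algebra_simps)?
    moreover have "1 + of_nat p * (2 / of_nat (3 * i + 1)) = (3 * of_nat (Suc (2 * n + i)) / of_nat (3 * i + 1) :: rat)"
      by (simp add: pn divide_simps) (simp add: algebra_simps)?
    moreover have "of_nat (3 * i + 3) = (3 * of_nat (Suc i) :: rat)" by simp
    moreover have "(of_nat (3 * i + 2) :: rat) \<noteq> 0" "(of_nat (3 * i + 1) :: rat) \<noteq> 0"
      by (simp_all only: of_nat_eq_0_iff)
    ultimately show ?thesis
      by (simp add: field_simps del: of_nat_Suc of_nat_add of_nat_mult)
  qed
  have "?A * ?B * fact (3 * n)
      = (\<Prod>i<n. 27 * (of_nat (Suc i) * of_nat (Suc (n + i)) * of_nat (Suc (2 * n + i))) :: rat)"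
    unfolding prod_triple_fact[symmetric] prod.distrib[symmetric] * ..
  also have "\<dots> = 27 ^ n * ((\<Prod>i<n. of_nat (Suc i)) * (\<Prod>i<n. of_nat (Suc (n + i)))
        * (\<Prod>i<n. of_nat (Suc (2 * n + i))))"
    by (simp only: prod.distrib prod_constant card_lessThan)
  also have "(\<Prod>i<n. of_nat (Suc i) :: rat) = fact n"
    using prod_shifted_fact[where m = 0 and n = n] by simp
  also have "fact n * (\<Prod>i<n. of_nat (Suc (n + i)) :: rat) = fact (2 * n)"
    using prod_shifted_fact[where m = n and n = n] unfolding mult_2 by (simp only: mult.commute)
  also have "fact (2 * n) * (\<Prod>i<n. of_nat (Suc (2 * n + i)) :: rat) = fact (3 * n)"
    using prod_shifted_fact[where m = "2 * n" and n = n] by (simp add: mult.commute)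
  finally show ?thesis by simp
qed

text \<open>To first order only the sums \<open>?A\<close> and \<open>?B\<close> of the coefficients
  of \<open>p\<close> in \<open>power_27_prod\<close> matter. Modulo \<open>p\<close>,
  \<open>?A\<close> vanishes and \<open>?B\<close> is \<open>- 2 / 3 * harm_rat n\<close>.\<close>

lemma power_27_cong: "pow_cong p 2 (27 ^ n) (1 - 2 / 3 * of_nat p * harm_rat n)"
proof -
  let ?A = "\<Sum>i<n. 1 / of_nat (3 * i + 2) :: rat"
  let ?B = "\<Sum>i<n. 2 / of_nat (3 * i + 1) :: rat"
  have I1: "1 / of_nat (3 * i + 2) \<in> p_integral_rats p" if "i < n" for i
    using that p pn by (intro p_integral_divide_of_nat not_p_dvd_between) auto
  have I2: "c / of_nat (3 * i + 1) \<in> p_integral_rats p" if "i < n" "c \<in> p_integral_rats p" for i c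
    using that p pn by (intro p_integral_divide_of_nat not_p_dvd_between) auto
  have I3: "1 / of_nat (Suc (n + i)) \<in> p_integral_rats p" if "i < n" for i
    using that p pn by (intro p_integral_divide_of_nat not_p_dvd_between) (auto simp del: of_nat_Suc)
  have I4: "1 / of_nat (n - i) \<in> p_integral_rats p" if "i < n" for i
    using that p pn by (intro p_integral_divide_of_nat not_p_dvd_between) auto
  have AB: "?A \<in> p_integral_rats p" "?B \<in> p_integral_rats p"
    by (intro p_integral_sum[OF p] I1 I2; simp add: p)+
  \<comment> \<open>\<open>3 i + 2\<close> and \<open>3 (n + i + 1)\<close> differ by
    \<open>p\<close>.\<close>
  have "pow_cong p 1 ?A (\<Sum>i<n. 1 / 3 * (1 / of_nat (Suc (n + i))))"
  proof (intro pow_cong_sum p)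
    fix i assume i: "i \<in> {..<n}"
    show "pow_cong p 1 (1 / of_nat (3 * i + 2)) (1 / 3 * (1 / of_nat (Suc (n + i))))"
    proof (rule pow_congI[OF p])
      show "1 / of_nat (3 * i + 2) * (1 / of_nat (Suc (n + i))) / 3 \<in> p_integral_rats p"
        using i by (intro p_integral_third p_integral_mult[OF p] I1 I3) auto
      show "1 / of_nat (3 * i + 2) - 1 / 3 * (1 / of_nat (Suc (n + i)))
          = of_nat p ^ 1 * (1 / of_nat (3 * i + 2) * (1 / of_nat (Suc (n + i))) / 3 :: rat)"
        by (simp add: pn divide_simps) (simp add: algebra_simps)?
    qed
  qed
  then have A1: "pow_cong p 1 ?A (1 / 3 * (harm_rat (2 * n) - harm_rat n))"
    unfolding mult_2 harm_rat_add sum_distrib_left .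
  have "pow_cong p 1 (1 / 3 * (harm_rat (2 * n) - harm_rat n)) 0"
    using pow_cong_mult_right[OF p p_integral_third[OF p_integral_1[OF p]]
        pow_cong_add[OF p harm_rat_double_cong pow_cong_refl[OF p, of _ "- harm_rat n"]]]
    by simp
  then have A: "pow_cong p 1 ?A 0" by (rule pow_cong_trans[OF p A1])
  \<comment> \<open>\<open>3 i + 1\<close> and \<open>3 (n - i)\<close> add up to \<open>p\<close>,
    hence the minus sign.\<close>
  have "pow_cong p 1 ?B (\<Sum>i<n. - 2 / 3 * (1 / of_nat (n - i)))"
  proof (intro pow_cong_sum p)
    fix i assume i: "i \<in> {..<n}"
    show "pow_cong p 1 (2 / of_nat (3 * i + 1)) (- 2 / 3 * (1 / of_nat (n - i)))"
    proof (rule pow_congI[OF p])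
      show "2 / of_nat (3 * i + 1) * (1 / of_nat (n - i)) / 3 \<in> p_integral_rats p"
        using i by (intro p_integral_third p_integral_mult[OF p] I2 I4) (auto simp: p)
      obtain j where "n = i + Suc j" using i by (auto simp: less_iff_Suc_add)
      then show "2 / of_nat (3 * i + 1) - - 2 / 3 * (1 / of_nat (n - i))
          = of_nat p ^ 1 * (2 / of_nat (3 * i + 1) * (1 / of_nat (n - i)) / 3 :: rat)"
        by (simp add: pn divide_simps) (simp add: algebra_simps)?
    qed
  qed
  then have B: "pow_cong p 1 ?B (- 2 / 3 * harm_rat n)"
    unfolding harm_rat_reverse sum_distrib_left .
  have "pow_cong p 2 ((\<Prod>i<n. 1 + of_nat p * (1 / of_nat (3 * i + 2)))
       * (\<Prod>i<n. 1 + of_nat p * (2 / of_nat (3 * i + 1)))) ((1 + of_nat p * ?A) * (1 + of_nat p * ?B))"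
    by (intro pow_cong_mult[OF p] pow_cong_prod_one_plus[OF p] p_integral_prod[OF p]
          p_integral_add[OF p] p_integral_mult[OF p] I1 I2 AB) (simp_all add: p)
  then have 1: "pow_cong p 2 (27 ^ n) ((1 + of_nat p * ?A) * (1 + of_nat p * ?B))"
    by (simp only: power_27_prod)
  have 2: "pow_cong p 2 ((1 + of_nat p * ?A) * (1 + of_nat p * ?B)) (1 + of_nat p * (?A + ?B))"
    using AB p by (intro pow_congI[of p "?A * ?B"]) (auto simp: algebra_simps power2_eq_square)
  have "pow_cong p 2 (of_nat p * (?A + ?B)) (of_nat p * (0 + - 2 / 3 * harm_rat n))"
    using pow_cong_Suc_mult[OF p pow_cong_add[OF p A B]] by (simp add: numeral_2_eq_2)
  from pow_cong_add[OF p pow_cong_refl[OF p, of _ 1] this]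
  have 3: "pow_cong p 2 (1 + of_nat p * (?A + ?B)) (1 - 2 / 3 * of_nat p * harm_rat n)"
    by (simp add: algebra_simps)
  show ?thesis
    by (rule pow_cong_trans[OF p 1 pow_cong_trans[OF p 2 3]])
qed

lemma p_integral_harm_rat: "harm_rat n \<in> p_integral_rats p"
  unfolding harm_rat_def using p pn
  by (intro p_integral_sum p_integral_divide_of_nat not_p_dvd_between) auto

text \<open>The added \<open>p H(n) / 3\<close> is the share of the other terms. The quotient is
  reached by comparing \<open>C(3n,n)\<close> with \<open>(1 - p H(n) / 3) 27^n\<close> and only
  then dividing by \<open>27^n\<close>.\<close>

lemma binomial_over_power_27_cong:
  "pow_cong p 2 (of_nat ((3 * n) choose n) / 27 ^ n + of_nat p * harm_rat n / 3) 1"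
proof -
  let ?H = "harm_rat n" and ?h = "of_nat p * harm_rat n / 3" and ?C = "of_nat ((3 * n) choose n) :: rat"
  have h: "?h \<in> p_integral_rats p"
    using p_integral_third p p_integral_harm_rat by simp
  have "pow_cong p 2 ((1 - ?h) * 27 ^ n) ((1 - ?h) * (1 - 2 / 3 * of_nat p * ?H))"
    using h p by (intro pow_cong_mult_right[OF p] power_27_cong) simp
  \<comment> \<open>The linear terms add up to \<open>- p H(n)\<close>; the witness is the
    coefficient \<open>2 H(n)^2 / 9\<close> of \<open>p^2\<close>.\<close>
  moreover have "pow_cong p 2 ((1 - ?h) * (1 - 2 / 3 * of_nat p * ?H)) (1 - of_nat p * ?H)"
    using p p_integral_harm_rat
    by (intro pow_congI[OF p, of "2 * (?H / 3) * (?H / 3)"] p_integral_mult p_integral_third)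
       (auto simp: field_simps power2_eq_square)
  ultimately have "pow_cong p 2 ((1 - ?h) * 27 ^ n) (1 - of_nat p * ?H)"
    by (rule pow_cong_trans[OF p])
  then have "pow_cong p 2 ?C ((1 - ?h) * 27 ^ n)"
    by (rule pow_cong_trans[OF p binomial_three_n_cong pow_cong_sym[OF p]])
  moreover have "1 / 27 ^ n \<in> p_integral_rats p"
    using p_integral_divide_of_nat[OF p p_integral_1[OF p] not_p_dvd_27_power[of n]] by simp
  ultimately have "pow_cong p 2 (1 / 27 ^ n * ?C) (1 / 27 ^ n * ((1 - ?h) * 27 ^ n))"
    by (intro pow_cong_mult_right[OF p])
  from pow_cong_add[OF p this pow_cong_refl[OF p, of _ ?h]] show ?thesis
    by simp
qed

section \<open>Assembly of the sum modulo \<open>p^2\<close>\<close>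

lemma central_trinomial_sum_cong:
  "pow_cong p 2
    (\<Sum>k = 0..p - 1. of_nat ((2 * k) choose k) * of_nat ((3 * k) choose k) / 27 ^ k * (of_nat p / of_nat (3 * k + 1)))
    (of_nat ((2 * n) choose n))"
proof -
  define f :: "nat \<Rightarrow> rat" where
    "f k = of_nat ((2 * k) choose k) * of_nat ((3 * k) choose k) / 27 ^ k * (of_nat p / of_nat (3 * k + 1))" for k
  define g :: "nat \<Rightarrow> rat" where
    "g k = (-1) ^ k * of_nat (n choose k) * of_nat ((n + k) choose k) / (3 * (of_nat k - of_nat n))" for k
  let ?B = "of_nat ((2 * n) choose n) :: rat" and ?C = "of_nat ((3 * n) choose n) :: rat"
  have n: "n \<in> {0..p - 1}" using pn by simp
  \<comment> \<open>The denominator \<open>3 n + 1\<close> is \<open>p\<close> itself and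
    cancels.\<close>
  have fn: "f n = ?B * (?C / 27 ^ n)"
    unfolding f_def pn by simp
  have "pow_cong p 2 (\<Sum>k\<in>{0..p - 1} - {n}. f k) (\<Sum>k\<in>{0..p - 1} - {n}. of_nat p * g k)"
    unfolding f_def g_def
    using prime_gt_0_nat[OF p] by (intro pow_cong_sum p term_cong) auto
  \<comment> \<open>For \<open>k > n\<close> the factor \<open>n choose k\<close> is zero.\<close>
  also have "(\<Sum>k\<in>{0..p - 1} - {n}. of_nat p * g k) = (\<Sum>k<n. of_nat p * g k)"
    using pn by (intro sum.mono_neutral_right) (auto simp: g_def)
  also have "(\<Sum>k<n. of_nat p * g k) = of_nat p * (1 / 3 * ?B * (2 * harm_rat n - harm_rat (2 * n)))"
    unfolding sum_distrib_left[symmetric] g_def legendre_coeff_sum by simp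
  finally have 1: "pow_cong p 2 (\<Sum>k\<in>{0..p - 1} - {n}. f k)
      (of_nat p * (1 / 3 * ?B * (2 * harm_rat n - harm_rat (2 * n))))" .
  have 2: "pow_cong p 2 (of_nat p * (1 / 3 * ?B * (2 * harm_rat n - harm_rat (2 * n))))
      (of_nat p * (1 / 3 * ?B * harm_rat n))"
  proof -
    have "pow_cong p 1 (- 1 * harm_rat (2 * n)) (- 1 * harm_rat n)"
      using p by (intro pow_cong_mult_right harm_rat_double_cong p_integral_minus) auto
    from pow_cong_add[OF p pow_cong_refl[OF p, of _ "2 * harm_rat n"] this]
    have "pow_cong p 1 (2 * harm_rat n - harm_rat (2 * n)) (harm_rat n)" by simp
    then have "pow_cong p 1 (1 / 3 * ?B * (2 * harm_rat n - harm_rat (2 * n))) (1 / 3 * ?B * harm_rat n)"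
      using p by (intro pow_cong_mult_right p_integral_mult p_integral_third) auto
    from pow_cong_Suc_mult[OF p this] show ?thesis by (simp only: numeral_2_eq_2 One_nat_def)
  qed
  have "(\<Sum>k = 0..p - 1. f k) = f n + (\<Sum>k\<in>{0..p - 1} - {n}. f k)"
    using n by (intro sum.remove) auto
  moreover have "?B * (?C / 27 ^ n + of_nat p * harm_rat n / 3) = f n + of_nat p * (1 / 3 * ?B * harm_rat n)"
    unfolding fn by (simp only: distrib_left mult_ac times_divide_eq_left times_divide_eq_right mult_1_left)
  ultimately have "pow_cong p 2 (\<Sum>k = 0..p - 1. f k) (?B * (?C / 27 ^ n + of_nat p * harm_rat n / 3))"
    using pow_cong_add[OF p pow_cong_refl[OF p, of _ "f n"] pow_cong_trans[OF p 1 2]] by (simp only:)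
  moreover have "pow_cong p 2 (?B * (?C / 27 ^ n + of_nat p * harm_rat n / 3)) (?B * 1)"
    by (intro pow_cong_mult_right[OF p] binomial_over_power_27_cong p_integral_of_nat[OF p])
  ultimately have "pow_cong p 2 (\<Sum>k = 0..p - 1. f k) (?B * 1)"
    by (rule pow_cong_trans[OF p])
  then show ?thesis
    unfolding f_def mult_1_right .
qed

end

theorem theorem3p3:
  fixes p :: nat
  assumes "prime p" and "[p = 1] (mod 3)"
  shows "p_integral_cong p
    (\<Sum>k = 0..p - 1.
       (of_nat ((2 * k) choose k) * of_nat ((3 * k) choose k) / 27 ^ k) * (of_nat p / of_nat (3 * k + 1)))
    (of_nat ((2 * (p - 1) div 3) choose ((p - 1) div 3)))
    (of_nat p ^ 2)"
proof -
  have p: "prime p" by fact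
  define n where "n = (p - 1) div 3"
  have "p mod 3 = 1" using assms(2) by (simp add: cong_def)
  then have pn: "p = 3 * n + 1" unfolding n_def by presburger
  have e: "2 * (p - 1) div 3 = 2 * n" "(p - 1) div 3 = n" using pn by simp_all
  obtain z where z: "z \<in> p_integral_rats p"
    "(\<Sum>k = 0..p - 1. of_nat ((2 * k) choose k) * of_nat ((3 * k) choose k) / 27 ^ k * (of_nat p / of_nat (3 * k + 1)))
      - of_nat ((2 * n) choose n) = of_nat p ^ 2 * z"
    using central_trinomial_sum_cong[OF p pn] unfolding pow_cong_def[OF p] by blast
  \<comment> \<open>Since \<open>pow_cong\<close> carries no membership, integrality of the sum is
    read off from this form.\<close>
  then have S: "(\<Sum>k = 0..p - 1. of_nat ((2 * k) choose k) * of_nat ((3 * k) choose k) / 27 ^ k * (of_nat p / of_nat (3 * k + 1)))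
      = of_nat ((2 * n) choose n) + of_nat p ^ 2 * z"
    by (simp only: diff_eq_eq add.commute)
  have "of_nat ((2 * n) choose n) + of_nat p ^ 2 * z \<in> p_integral_rats p"
    using z(1) by (intro p_integral_add p_integral_mult p_integral_power p_integral_of_nat p)
  then show ?thesis
    unfolding p_integral_cong_def e S using z(1) p by auto
qed

end
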